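(* Assume $f'(\bm i^0)\le 0$ and that $f'(\bm i)>0$ for at least one $\bm i\in\mathcal S$. Then the trigger set control policy whose continue set is $\overline{\mathcal U}^*=\{\bm i\in\mathcal S:f'(\bm i)\le0\}$ and whose stopping (trigger) set is $\mathcal U^*=\{\bm i\in\mathcal S:f'(\bm i)>0\}$ is optimal, i.e. it minimizes the long-run average cost: $\alpha_{\mathcal U^*}=\alpha^*$.
   Context: Setting. There are $J\ge 1$ items. For each item $j$ let $Q_j\ge 1$ be an integer (slot capacity), $\lambda_j>0$ the demand rate and $b_j>0$ the unit stockout cost. $A>0$ is the fixed replenishment cost and $\tau>0$ the lead time. Put $\Lambda=\sum_{j=1}^J\lambda_j$ and $p_j=\lambda_j/\Lambda$. $D_j(\tau)$ is a Poisson random variable with mean $\lambda_j\tau$ (so $P(D_j(\tau)=r)=0$ for $r<0$). The state space is $\mathcal S=\{\bm i=(i_1,\dots,i_J)\in\mathbb Z^J: i_j\le Q_j\ \forall j\}$; the initial state is $\bm i^0=\bm Q=(Q_1,\dots,Q_J)$; $\bm i^{-j}$ denotes $\bm i$ with its $j$-th coordinate decreased by $1$. The expected cost of triggering a replenishment in state $\bm i$ is $$G(\bm i)=A+\sum_{j=1}^J b_j\sum_{r=i_j}^\infty (r-i_j)P(D_j(\tau)=r).$$ Dynamics. Starting from $\bm i^0$, the chain $\bm i^0,\bm i^1,\bm i^2,\dots$ moves at each step from $\bm i$ to $\bm i^{-j}$ with probability $p_j$; each step takes mean time $1/\Lambda$. A trigger set is a subset $\mathcal U\subset\mathcal S$,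 with continue set $\mathcal S\setminus\mathcal U$. When the chain first enters $\mathcal U$, at step $N_{\mathcal U}$, a replenishment is triggered, which takes time $\tau$, costs $G(\bm i^{N_{\mathcal U}})$ (the only cost in the cycle) and returns the system to $\bm i^0$. $\mathcal U$ is admissible if $\bm i^0\notin\mathcal U$ and $E[N_{\mathcal U}]<\infty$. The long-run average cost per unit time of an admissible $\mathcal U$ is $$\alpha_{\mathcal U}=\frac{E[G(\bm i^{N_{\mathcal U}})]}{\tau+E[N_{\mathcal U}]/\Lambda},$$ and $\alpha^*=\min\{\alpha_{\mathcal U}:\mathcal U\text{ admissible}\}$ (the minimum is taken to be attained). The entrance fee of state $\bm i$ is $$f'(\bm i)=-\frac{\alpha^*}{\Lambda}+\sum_{j=1}^J p_jb_jP(D_j(\tau)\ge i_j).$$ *)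

theory Defs
  imports "HOL-Probability.Probability"
begin

text \<open>The items are the elements of a finite (hence nonempty) index type; a state
  \<open>i = (i\<^sub>1, \<dots>, i\<^sub>J)\<close> is a function from items to integers, negative values being allowed.\<close>

record 'j inventory =
  capacity :: "'j \<Rightarrow> int"
  rate :: "'j \<Rightarrow> real"
  stockout_cost :: "'j \<Rightarrow> real"
  fixed_cost :: real
  lead_time :: real

definition states :: "'j inventory \<Rightarrow> ('j \<Rightarrow> int) set" where
  "states P = {i. \<forall>j. i j \<le> capacity P j}"

definition total_rate :: "('j::finite) inventory \<Rightarrow> real" where
  "total_rate P = (\<Sum>j\<in>UNIV. rate P j)"

definition item_prob :: "('j::finite) inventory \<Rightarrow> 'j \<Rightarrow> real" where
  "item_prob P j = rate P j / total_rate P"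

definition lead_demand :: "'j inventory \<Rightarrow> 'j \<Rightarrow> nat pmf" where
  "lead_demand P j = poisson_pmf (rate P j * lead_time P)"

definition trigger_cost :: "('j::finite) inventory \<Rightarrow> ('j \<Rightarrow> int) \<Rightarrow> real" where
  "trigger_cost P i = fixed_cost P +
     (\<Sum>j\<in>UNIV. stockout_cost P j *
        (\<Sum>\<^sub>\<infinity>r\<in>{i j..}. real_of_int (r - i j) *
           measure_pmf.prob (lead_demand P j) {d. int d = r}))"

text \<open>The chain is realised canonically: the items demanded at steps \<open>0, 1, 2, \<dots>\<close> form an
  i.i.d. sequence \<open>\<omega>\<close>, each item \<open>j\<close> having probability \<open>item_prob P j\<close>, and each demand
  lowers the corresponding coordinate of the state by one.\<close>

definition item_pmf :: "('j::finite) inventory \<Rightarrow> 'j pmf" where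
  "item_pmf P = embed_pmf (item_prob P)"

lemma pmf_item_pmf:
  fixes P :: "('j::finite) inventory"
  assumes "\<And>j. rate P j > 0"
  shows "pmf (item_pmf P) j = item_prob P j"
proof -
  have pos: "total_rate P > 0"
    unfolding total_rate_def by (rule sum_pos) (use assms in auto)
  have nonneg: "item_prob P k \<ge> 0" for k
    using pos assms[of k] by (simp add: item_prob_def)
  have "(\<Sum>k\<in>UNIV. item_prob P k) = 1"
    using pos by (simp add: item_prob_def total_rate_def flip: sum_divide_distrib)
  then have "(\<integral>\<^sup>+k. ennreal (item_prob P k) \<partial>count_space UNIV) = 1"
    by (simp add: nn_integral_count_space_finite sum_ennreal nonneg)
  then show ?thesis
    unfolding item_pmf_def by (intro pmf_embed_pmf nonneg)
qed

definition demand_space :: "('j::finite) inventory \<Rightarrow> 'j stream measure" where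
  "demand_space P = stream_space (measure_pmf (item_pmf P))"

primrec chain :: "'j inventory \<Rightarrow> 'j stream \<Rightarrow> nat \<Rightarrow> 'j \<Rightarrow> int" where
  "chain P \<omega> 0 = capacity P"
| "chain P \<omega> (Suc n) = (chain P \<omega> n)(\<omega> !! n := chain P \<omega> n (\<omega> !! n) - 1)"

text \<open>The first entrance step; it is \<open>\<infinity>\<close> if the trigger set is never entered.\<close>

definition trigger_step :: "'j inventory \<Rightarrow> ('j \<Rightarrow> int) set \<Rightarrow> 'j stream \<Rightarrow> enat" where
  "trigger_step P U \<omega> = (INF n\<in>{n. chain P \<omega> n \<in> U}. enat n)"

definition expected_steps :: "('j::finite) inventory \<Rightarrow> ('j \<Rightarrow> int) set \<Rightarrow> ennreal" where
  "expected_steps P U = (\<integral>\<^sup>+\<omega>. ennreal_of_enat (trigger_step P U \<omega>) \<partial>demand_space P)"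

definition admissible :: "('j::finite) inventory \<Rightarrow> ('j \<Rightarrow> int) set \<Rightarrow> bool" where
  "admissible P U \<longleftrightarrow> U \<subseteq> states P \<and> capacity P \<notin> U \<and> expected_steps P U < \<infinity>"

text \<open>For an admissible trigger set, \<open>trigger_step\<close> is almost surely finite and
  \<open>expected_steps\<close> is finite, so the conversions \<open>the_enat\<close> and \<open>enn2real\<close> lose nothing.\<close>

definition expected_cost :: "('j::finite) inventory \<Rightarrow> ('j \<Rightarrow> int) set \<Rightarrow> real" where
  "expected_cost P U =
     (\<integral>\<omega>. trigger_cost P (chain P \<omega> (the_enat (trigger_step P U \<omega>))) \<partial>demand_space P)"

definition average_cost :: "('j::finite) inventory \<Rightarrow> ('j \<Rightarrow> int) set \<Rightarrow> real" where
  "average_cost P U =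
     expected_cost P U / (lead_time P + enn2real (expected_steps P U) / total_rate P)"

definition optimal_cost :: "('j::finite) inventory \<Rightarrow> real" where
  "optimal_cost P = (INF U\<in>{U. admissible P U}. average_cost P U)"

definition entrance_fee :: "('j::finite) inventory \<Rightarrow> ('j \<Rightarrow> int) \<Rightarrow> real" where
  "entrance_fee P i = - optimal_cost P / total_rate P +
     (\<Sum>j\<in>UNIV. item_prob P j * stockout_cost P j *
        measure_pmf.prob (lead_demand P j) {d. int d \<ge> i j})"

definition continue_set :: "'j inventory \<Rightarrow> ('j \<Rightarrow> int) set \<Rightarrow> ('j \<Rightarrow> int) set" where
  "continue_set P U = states P - U"

end

(* G rises by b_j P(D_j \<ge> i_j) on a demand for item j, so by Dynkin's formula
   E[G(i^N)] - (alpha*/Lambda) E[N] = G(i^0) + E[sum of the fees f' of the states left before step N].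
   The fee increases along every path, so it is pathwise best to stop on entering {f' > 0}. Comparing
   with an optimal trigger set, for which the left-hand side is alpha* tau, shows that this rule has
   average cost at most alpha*. *)

theory Submission
  imports Defs
begin

section \<open>Functionals of i.i.d. sequences\<close>

text \<open>The value \<alpha>* linearises the ratio: a rule has average cost at most \<alpha>*
  exactly when its expected cost minus (\<alpha>*/\<Lambda>) E[N] is at most \<alpha>* \<tau>. This
  is the origin of the constant in the fee. The obstacle is that the fee takes both signs while the
  trigger step is unbounded. Dynkin's formula is therefore proved for nonnegative increments, in
  \<open>ennreal\<close>, where series and integral commute; the constant is subtracted only
  afterwards, which E[N] < \<infinity> permits. The pathwise comparison works for any order of the
  two trigger steps: stopping earlier forgoes nonpositive fees, stopping later adds nonnegative
  ones. The two assumptions on the fee make the rule admissible. A nonpositive fee at the start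
  keeps the initial state out of the trigger set. A single state of positive fee puts every state
  below it into the trigger set, and the chain gets below it in finite expected time because every
  item has positive demand probability.\<close>

text \<open>A function of a finite prefix factors through \<open>stake n\<close>, whose values are
  lists over a countable type and carry the discrete structure. The measurability facts about the
  chain rest on this.\<close>

lemma measurable_of_stake:
  fixes f :: "'a::countable stream \<Rightarrow> 'b"
  assumes "\<And>\<omega> \<omega>'. stake n \<omega> = stake n \<omega>' \<Longrightarrow> f \<omega> = f \<omega>'" and "range f \<subseteq> space N"
  shows "f \<in> measurable (stream_space (measure_pmf p)) N"
proof -
  have eq: "f = (\<lambda>xs. f (xs @- sconst undefined)) \<circ> stake n"
    by (rule ext) (auto intro!: assms(1) simp: stake_shift)
  have sets: "sets (stream_space (measure_pmf p)) = sets (stream_space (count_space UNIV))"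
    by (rule sets_stream_space_cong) simp
  show ?thesis
    unfolding measurable_cong_sets[OF sets refl]
    by (subst eq, rule measurable_comp[OF measurable_stake]) (use assms(2) in auto)
qed

lemma stake_Suc_eqD:
  assumes "stake (Suc k) \<omega> = stake (Suc k) \<omega>'"
  shows "stake k \<omega> = stake k \<omega>'" and "\<omega> !! k = \<omega>' !! k"
  using assms unfolding stake_Suc by auto

text \<open>Entry k is independent of the k entries before it, so it can be integrated out with the
  prefix frozen. The induction peels off the head of the stream and absorbs it into g, which is why
  g is generalised.\<close>

lemma nn_integral_next_coordinate:
  fixes g :: "'a::countable stream \<Rightarrow> 'a \<Rightarrow> ennreal"
  assumes "\<And>\<omega> \<omega>'. stake k \<omega> = stake k \<omega>' \<Longrightarrow> g \<omega> = g \<omega>'"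
  shows "(\<integral>\<^sup>+\<omega>. g \<omega> (\<omega> !! k) \<partial>stream_space (measure_pmf p)) =
    (\<integral>\<^sup>+\<omega>. (\<integral>\<^sup>+x. g \<omega> x \<partial>measure_pmf p) \<partial>stream_space (measure_pmf p))"
  using assms
proof (induction k arbitrary: g)
  case 0
  interpret S: prob_space "stream_space (measure_pmf p)"
    by (rule prob_space.prob_space_stream_space[OF prob_space_measure_pmf])
  \<comment> \<open>The empty prefix carries no information, so g does not depend on the stream at
    all.\<close>
  define h where "h = g undefined"
  have [simp]: "g \<omega> = h" for \<omega> unfolding h_def by (rule 0) simp
  have "(\<integral>\<^sup>+\<omega>. h (\<omega> !! 0) \<partial>stream_space (measure_pmf p)) = (\<integral>\<^sup>+x. h x \<partial>measure_pmf p)"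
    by (subst prob_space.nn_integral_stream_space[OF prob_space_measure_pmf])
      (auto intro!: measurable_of_stake[of "Suc 0"] simp: S.emeasure_space_1)
  then show ?case by (simp add: S.emeasure_space_1)
next
  case (Suc k)
  have "(\<integral>\<^sup>+\<omega>. g \<omega> (\<omega> !! Suc k) \<partial>stream_space (measure_pmf p)) =
    (\<integral>\<^sup>+x. (\<integral>\<^sup>+\<omega>. g (x ## \<omega>) (\<omega> !! k) \<partial>stream_space (measure_pmf p)) \<partial>measure_pmf p)"
  proof (subst prob_space.nn_integral_stream_space[OF prob_space_measure_pmf])
    show "(\<lambda>\<omega>. g \<omega> (\<omega> !! Suc k)) \<in> borel_measurable (stream_space (measure_pmf p))"
    proof (rule measurable_of_stake[of "Suc (Suc k)"])
      fix \<omega> \<omega>' :: "'a stream" assume eq: "stake (Suc (Suc k)) \<omega> = stake (Suc (Suc k)) \<omega>'"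
      show "g \<omega> (\<omega> !! Suc k) = g \<omega>' (\<omega>' !! Suc k)"
        using Suc.prems[OF stake_Suc_eqD(1)[OF eq]] stake_Suc_eqD(2)[OF eq] by simp
    qed auto
  qed simp
  also have "\<dots> = (\<integral>\<^sup>+x. (\<integral>\<^sup>+\<omega>. (\<integral>\<^sup>+y. g (x ## \<omega>) y \<partial>measure_pmf p)
      \<partial>stream_space (measure_pmf p)) \<partial>measure_pmf p)"
    by (intro nn_integral_cong Suc.IH Suc.prems) simp
  also have "\<dots> = (\<integral>\<^sup>+\<omega>. (\<integral>\<^sup>+y. g \<omega> y \<partial>measure_pmf p) \<partial>stream_space (measure_pmf p))"
  proof (rule prob_space.nn_integral_stream_space[OF prob_space_measure_pmf, symmetric])
    show "(\<lambda>\<omega>. \<integral>\<^sup>+y. g \<omega> y \<partial>measure_pmf p) \<in> borel_measurable (stream_space (measure_pmf p))"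
    proof (rule measurable_of_stake[of "Suc k"])
      fix \<omega> \<omega>' :: "'a stream" assume "stake (Suc k) \<omega> = stake (Suc k) \<omega>'"
      then have "g \<omega> = g \<omega>'" by (rule Suc.prems)
      then show "(\<integral>\<^sup>+y. g \<omega> y \<partial>measure_pmf p) = (\<integral>\<^sup>+y. g \<omega>' y \<partial>measure_pmf p)" by simp
    qed simp
  qed
  finally show ?case .
qed

section \<open>The chain and the entrance step\<close>

lemma chain_cong:
  assumes "stake n \<omega> = stake n \<omega>'" and "m \<le> n"
  shows "chain P \<omega> m = chain P \<omega>' m"
  using assms(2)
proof (induction m)
  case (Suc m)
  have "\<omega> !! m = \<omega>' !! m" using assms(1) Suc.prems by (metis Suc_le_lessD stake_nth)
  then show ?case using Suc by simp
qed simp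

lemma chain_le_capacity: "chain P \<omega> n j \<le> capacity P j"
proof (induction n arbitrary: j)
  case (Suc n)
  show ?case using Suc[of j] Suc[of "\<omega> !! n"] by (auto simp: fun_upd_apply)
qed simp

lemma chain_in_states: "chain P \<omega> n \<in> states P"
  by (simp add: states_def chain_le_capacity)

lemma chain_antimono: "m \<le> n \<Longrightarrow> chain P \<omega> n j \<le> chain P \<omega> m j"
  by (rule lift_Suc_antimono_le[of "\<lambda>n. chain P \<omega> n j"]) auto

lemma less_trigger_step_iff:
  "enat k < trigger_step P U \<omega> \<longleftrightarrow> (\<forall>m\<le>k. chain P \<omega> m \<notin> U)"
proof -
  have "enat k < trigger_step P U \<omega> \<longleftrightarrow> (\<forall>n. chain P \<omega> n \<in> U \<longrightarrow> k < n)"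
    unfolding trigger_step_def Suc_ile_eq[symmetric] le_INF_iff by (simp add: Suc_le_eq)
  also have "\<dots> \<longleftrightarrow> (\<forall>m\<le>k. chain P \<omega> m \<notin> U)" by (meson not_less)
  finally show ?thesis .
qed

text \<open>State k is built from the demands 0 to k - 1. Whether step k is still taken is thus
  decided before demand k is drawn, which is what allows that demand to be averaged
  separately.\<close>

lemma less_trigger_step_cong:
  assumes "stake k \<omega> = stake k \<omega>'"
  shows "enat k < trigger_step P U \<omega> \<longleftrightarrow> enat k < trigger_step P U \<omega>'"
  unfolding less_trigger_step_iff by (simp add: chain_cong[OF assms] cong: conj_cong)

lemma measurable_demand_space_of_stake:
  fixes f :: "('j::finite) stream \<Rightarrow> 'b"
  assumes "\<And>\<omega> \<omega>'. stake n \<omega> = stake n \<omega>' \<Longrightarrow> f \<omega> = f \<omega>'" and "range f \<subseteq> space N"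
  shows "f \<in> measurable (demand_space P) N"
  unfolding demand_space_def by (rule measurable_of_stake[OF assms])

lemma measurable_less_trigger_step [measurable]:
  "Measurable.pred (demand_space P) (\<lambda>\<omega>. enat k < trigger_step P U \<omega>)"
  by (rule measurable_demand_space_of_stake[of k], erule less_trigger_step_cong) simp

lemma measurable_trigger_step [measurable]:
  "trigger_step P U \<in> measurable (demand_space P) (count_space UNIV)"
proof -
  have "Measurable.pred (demand_space P) (\<lambda>\<omega>. trigger_step P U \<omega> = t)" for t
  proof (cases t)
    case (enat n)
    have eq: "trigger_step P U \<omega> = t \<longleftrightarrow>
      \<not> enat n < trigger_step P U \<omega> \<and> (\<forall>m<n. enat m < trigger_step P U \<omega>)" for \<omega>
    proof (cases "trigger_step P U \<omega>")
      case (enat l)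
      then show ?thesis
        using \<open>t = enat n\<close> by simp (metis linorder_less_linear order_less_irrefl)
    qed (simp add: enat)
    show ?thesis unfolding eq by measurable
  next
    case infinity
    have eq: "trigger_step P U \<omega> = t \<longleftrightarrow> (\<forall>m. enat m < trigger_step P U \<omega>)" for \<omega>
    proof (cases "trigger_step P U \<omega>")
      case (enat l)
      then show ?thesis using infinity by auto
    qed (simp add: infinity)
    show ?thesis unfolding eq by measurable
  qed
  then have "trigger_step P U -` {t} \<inter> space (demand_space P) \<in> sets (demand_space P)" for t
    unfolding pred_def vimage_singleton_eq vimage_def by (simp add: Int_def conj_commute)
  then show ?thesis
    by (subst measurable_count_space_eq2_countable) simp_all
qed

text \<open>Resolves a stopping time into events that each depend on a finite prefix, with the value
  \<infinity> included.\<close>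

lemma ennreal_of_enat_eq_suminf:
  "ennreal_of_enat t = (\<Sum>k. if enat k < t then 1 else 0)"
proof (cases t)
  case (enat n)
  have "(\<Sum>k. if enat k < t then 1 else 0 :: ennreal) = (\<Sum>k<n. if enat k < t then 1 else 0)"
    by (rule suminf_finite) (auto simp: enat)
  then show ?thesis by (simp add: enat)
next
  case infinity
  have "suminf (\<lambda>k::nat. 1 :: ennreal) = nn_integral (count_space UNIV) (\<lambda>k::nat. 1)"
    by (rule nn_integral_count_space_nat[symmetric])
  then show ?thesis by (simp add: infinity)
qed

lemma ennreal_sum_lessThan_eq_suminf:
  assumes "\<And>k. 0 \<le> a k"
  shows "ennreal (\<Sum>k<n. a k) = (\<Sum>k. if enat k < enat n then ennreal (a k) else 0)"
proof -
  have "(\<Sum>k. if enat k < enat n then ennreal (a k) else 0) =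
      (\<Sum>k<n. if enat k < enat n then ennreal (a k) else 0)"
    by (rule suminf_finite) auto
  then show ?thesis using assms by (simp add: sum_ennreal)
qed

text \<open>Dynkin's formula. The increments are nonnegative, so that the stopping time needs no
  truncation and may be infinite.\<close>

lemma nn_integral_increments_until_trigger:
  fixes P :: "('j::finite) inventory" and \<phi> :: "('j \<Rightarrow> int) \<Rightarrow> 'j \<Rightarrow> ennreal"
  shows "(\<integral>\<^sup>+\<omega>. (\<Sum>k. if enat k < trigger_step P U \<omega> then \<phi> (chain P \<omega> k) (\<omega> !! k) else 0)
      \<partial>demand_space P) =
    (\<integral>\<^sup>+\<omega>. (\<Sum>k. if enat k < trigger_step P U \<omega>
        then (\<integral>\<^sup>+j. \<phi> (chain P \<omega> k) j \<partial>measure_pmf (item_pmf P)) else 0) \<partial>demand_space P)"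
proof -
  \<comment> \<open>With the indicator built in, \<open>g k\<close> depends on the first k demands
    only, so demand k can be integrated out of each term of the series.\<close>
  define g where "g k \<omega> j = (if enat k < trigger_step P U \<omega> then \<phi> (chain P \<omega> k) j else 0)"
    for k \<omega> j
  have g_cong: "g k \<omega> = g k \<omega>'" if "stake k \<omega> = stake k \<omega>'" for k \<omega> \<omega>'
    unfolding g_def less_trigger_step_cong[OF that] chain_cong[OF that order_refl] ..
  have [measurable]: "(\<lambda>\<omega>. g k \<omega> (\<omega> !! k)) \<in> borel_measurable (demand_space P)" for k
  proof (rule measurable_demand_space_of_stake[of "Suc k"])
    fix \<omega> \<omega>' :: "'j stream" assume eq: "stake (Suc k) \<omega> = stake (Suc k) \<omega>'"
    show "g k \<omega> (\<omega> !! k) = g k \<omega>' (\<omega>' !! k)"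
      using g_cong[OF stake_Suc_eqD(1)[OF eq]] stake_Suc_eqD(2)[OF eq] by simp
  qed auto
  have [measurable]: "(\<lambda>\<omega>. \<integral>\<^sup>+j. g k \<omega> j \<partial>measure_pmf (item_pmf P)) \<in> borel_measurable (demand_space P)"
    for k
    by (rule measurable_demand_space_of_stake[of k]) (auto dest!: g_cong)
  have "(\<integral>\<^sup>+\<omega>. (\<Sum>k. g k \<omega> (\<omega> !! k)) \<partial>demand_space P) =
      (\<Sum>k. \<integral>\<^sup>+\<omega>. g k \<omega> (\<omega> !! k) \<partial>demand_space P)"
    by (rule nn_integral_suminf) simp
  also have "\<dots> = (\<Sum>k. \<integral>\<^sup>+\<omega>. (\<integral>\<^sup>+j. g k \<omega> j \<partial>measure_pmf (item_pmf P)) \<partial>demand_space P)"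
    unfolding demand_space_def by (subst nn_integral_next_coordinate) (auto intro: g_cong)
  also have "\<dots> = (\<integral>\<^sup>+\<omega>. (\<Sum>k. \<integral>\<^sup>+j. g k \<omega> j \<partial>measure_pmf (item_pmf P)) \<partial>demand_space P)"
    by (rule nn_integral_suminf[symmetric]) simp
  finally have "(\<integral>\<^sup>+\<omega>. (\<Sum>k. g k \<omega> (\<omega> !! k)) \<partial>demand_space P) =
      (\<integral>\<^sup>+\<omega>. (\<Sum>k. \<integral>\<^sup>+j. g k \<omega> j \<partial>measure_pmf (item_pmf P)) \<partial>demand_space P)" .
  moreover have "(\<integral>\<^sup>+j. g k \<omega> j \<partial>measure_pmf (item_pmf P)) = (if enat k < trigger_step P U \<omega>
      then (\<integral>\<^sup>+j. \<phi> (chain P \<omega> k) j \<partial>measure_pmf (item_pmf P)) else 0)" for k \<omega>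
    by (simp add: g_def)
  ultimately show ?thesis by (simp add: g_def)
qed

section \<open>Stopped sums\<close>

lemma prob_space_demand_space: "prob_space (demand_space P)"
  unfolding demand_space_def by (rule prob_space.prob_space_stream_space[OF prob_space_measure_pmf])

lemma measurable_stopped_sum [measurable]:
  fixes a :: "nat \<Rightarrow> ('j::finite) stream \<Rightarrow> real"
  assumes [measurable]: "\<And>k. a k \<in> borel_measurable (demand_space P)"
  shows "(\<lambda>\<omega>. \<Sum>k<the_enat (trigger_step P U \<omega>). a k \<omega>) \<in> borel_measurable (demand_space P)"
proof (rule measurable_compose_countable[where f = "\<lambda>n \<omega>. \<Sum>k<n. a k \<omega>"])
  show "(\<lambda>\<omega>. the_enat (trigger_step P U \<omega>)) \<in> measurable (demand_space P) (count_space UNIV)"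
    by (rule measurable_compose[OF measurable_trigger_step]) simp
qed simp

lemma AE_trigger_step_finite:
  assumes "expected_steps P U < \<infinity>"
  shows "AE \<omega> in demand_space P. trigger_step P U \<omega> \<noteq> \<infinity>"
proof -
  have "(\<lambda>\<omega>. ennreal_of_enat (trigger_step P U \<omega>)) \<in> borel_measurable (demand_space P)"
    by (rule measurable_compose[OF measurable_trigger_step]) simp
  then have "AE \<omega> in demand_space P. ennreal_of_enat (trigger_step P U \<omega>) \<noteq> \<infinity>"
    by (rule nn_integral_PInf_AE) (use assms in \<open>auto simp: expected_steps_def\<close>)
  then show ?thesis by eventually_elim (metis ennreal_of_enat_infty)
qed

text \<open>\<open>the_enat\<close> is unspecified at \<infinity>, but a finite expectation confines
  that value to a null set; elsewhere the series is the finite sum.\<close>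

lemma nn_integral_stopped_sum:
  assumes "expected_steps P U < \<infinity>" and "\<And>k \<omega>. 0 \<le> a k \<omega>"
  shows "(\<integral>\<^sup>+\<omega>. ennreal (\<Sum>k<the_enat (trigger_step P U \<omega>). a k \<omega>) \<partial>demand_space P) =
    (\<integral>\<^sup>+\<omega>. (\<Sum>k. if enat k < trigger_step P U \<omega> then ennreal (a k \<omega>) else 0) \<partial>demand_space P)"
proof (rule nn_integral_cong_AE)
  show "AE \<omega> in demand_space P. ennreal (\<Sum>k<the_enat (trigger_step P U \<omega>). a k \<omega>) =
      (\<Sum>k. if enat k < trigger_step P U \<omega> then ennreal (a k \<omega>) else 0)"
    using AE_trigger_step_finite[OF assms(1)]
  proof eventually_elim
    case (elim \<omega>)
    then obtain n where "trigger_step P U \<omega> = enat n" by auto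
    then show ?case
      using ennreal_sum_lessThan_eq_suminf[of "\<lambda>k. a k \<omega>" n] assms(2) by simp
  qed
qed

lemma
  assumes "expected_steps P U < \<infinity>"
  shows integrable_the_trigger_step:
      "integrable (demand_space P) (\<lambda>\<omega>. real (the_enat (trigger_step P U \<omega>)))" (is ?int)
    and integral_the_trigger_step:
      "(\<integral>\<omega>. real (the_enat (trigger_step P U \<omega>)) \<partial>demand_space P) = enn2real (expected_steps P U)"
proof -
  have eq: "(\<integral>\<^sup>+\<omega>. ennreal (real (the_enat (trigger_step P U \<omega>))) \<partial>demand_space P) = expected_steps P U"
    using nn_integral_stopped_sum[OF assms, of "\<lambda>_ _. 1"]
    by (simp add: expected_steps_def ennreal_of_enat_eq_suminf cong: if_cong)
  have [measurable]:
    "(\<lambda>\<omega>. real (the_enat (trigger_step P U \<omega>))) \<in> borel_measurable (demand_space P)"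
    using measurable_stopped_sum[of "\<lambda>_ _. 1" P U] by simp
  show ?int by (rule integrableI_nonneg) (use assms in \<open>simp_all add: eq\<close>)
  show "(\<integral>\<omega>. real (the_enat (trigger_step P U \<omega>)) \<partial>demand_space P) = enn2real (expected_steps P U)"
    by (subst integral_eq_nn_integral) (simp_all add: eq)
qed

text \<open>The sum is dominated by B times the trigger step, which is integrable.\<close>

lemma integrable_stopped_sum:
  fixes a :: "nat \<Rightarrow> ('j::finite) stream \<Rightarrow> real"
  assumes "expected_steps P U < \<infinity>" and [measurable]: "\<And>k. a k \<in> borel_measurable (demand_space P)"
    and "\<And>k \<omega>. \<bar>a k \<omega>\<bar> \<le> B"
  shows "integrable (demand_space P) (\<lambda>\<omega>. \<Sum>k<the_enat (trigger_step P U \<omega>). a k \<omega>)"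
proof (rule Bochner_Integration.integrable_bound)
  show "integrable (demand_space P) (\<lambda>\<omega>. B * real (the_enat (trigger_step P U \<omega>)))"
    using integrable_the_trigger_step[OF assms(1)] by simp
  have "norm (\<Sum>k<n. a k \<omega>) \<le> norm (B * real n)" for n \<omega>
  proof -
    have "0 \<le> B" using assms(3)[of undefined undefined] by linarith
    moreover have "\<bar>\<Sum>k<n. a k \<omega>\<bar> \<le> (\<Sum>k<n. B)"
      by (rule order_trans[OF sum_abs]) (rule sum_mono, rule assms(3))
    ultimately show ?thesis by (simp add: mult.commute)
  qed
  then show "AE \<omega> in demand_space P. norm (\<Sum>k<the_enat (trigger_step P U \<omega>). a k \<omega>)
      \<le> norm (B * real (the_enat (trigger_step P U \<omega>)))"
    by simp
qed measurable

lemma measurable_increment [measurable]: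
  fixes \<phi> :: "(('j::finite) \<Rightarrow> int) \<Rightarrow> 'j \<Rightarrow> real"
  shows "(\<lambda>\<omega>. \<phi> (chain P \<omega> k) (\<omega> !! k)) \<in> borel_measurable (demand_space P)"
proof (rule measurable_demand_space_of_stake[of "Suc k"])
  fix \<omega> \<omega>' :: "'j stream" assume eq: "stake (Suc k) \<omega> = stake (Suc k) \<omega>'"
  show "\<phi> (chain P \<omega> k) (\<omega> !! k) = \<phi> (chain P \<omega>' k) (\<omega>' !! k)"
    using chain_cong[OF eq, of k P] stake_Suc_eqD(2)[OF eq] by simp
qed simp

text \<open>Dynkin's formula carried over to the reals: by nonnegativity both sides are the real
  value of one and the same extended integral.\<close>

lemma integral_increments_until_trigger:
  fixes P :: "('j::finite) inventory" and \<phi> :: "('j \<Rightarrow> int) \<Rightarrow> 'j \<Rightarrow> real"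
  assumes "expected_steps P U < \<infinity>" and "\<And>i j. 0 \<le> \<phi> i j"
  shows "(\<integral>\<omega>. (\<Sum>k<the_enat (trigger_step P U \<omega>). \<phi> (chain P \<omega> k) (\<omega> !! k)) \<partial>demand_space P) =
    (\<integral>\<omega>. (\<Sum>k<the_enat (trigger_step P U \<omega>).
      \<Sum>j\<in>UNIV. pmf (item_pmf P) j * \<phi> (chain P \<omega> k) j) \<partial>demand_space P)"
proof -
  have mean: "(\<integral>\<^sup>+j. ennreal (\<phi> i j) \<partial>measure_pmf (item_pmf P)) =
      ennreal (\<Sum>j\<in>UNIV. pmf (item_pmf P) j * \<phi> i j)" for i
    by (subst nn_integral_measure_pmf_support[of UNIV])
      (simp_all add: assms(2) mult.commute flip: sum_ennreal ennreal_mult')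
  have nonneg: "0 \<le> (\<Sum>j\<in>UNIV. pmf (item_pmf P) j * \<phi> i j)" for i
    by (simp add: assms(2) sum_nonneg)
  have [measurable]: "(\<lambda>\<omega>. \<Sum>j\<in>UNIV. pmf (item_pmf P) j * \<phi> (chain P \<omega> k) j)
      \<in> borel_measurable (demand_space P)" for k
    using measurable_increment[of "\<lambda>i _. \<Sum>j\<in>UNIV. pmf (item_pmf P) j * \<phi> i j"] .
  show ?thesis
    using nn_integral_increments_until_trigger[of P U "\<lambda>i j. ennreal (\<phi> i j)"]
    by (simp add: integral_eq_nn_integral sum_nonneg assms(2) nonneg mean nn_integral_stopped_sum[OF assms(1)]
        cong: if_cong)
qed

section \<open>Trigger cost along the chain\<close>

text \<open>The positive part frees the index set from i, so that the shortages at i and i - 1 can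
  be compared term by term.\<close>

lemma infsum_shortage_eq:
  fixes p :: "nat pmf" and i :: int
  shows "(\<Sum>\<^sub>\<infinity>r\<in>{i..}. real_of_int (r - i) * measure_pmf.prob p {d. int d = r}) =
    (\<Sum>\<^sub>\<infinity>n. max 0 (real n - real_of_int i) * pmf p n)"
proof -
  define f where "f r = max 0 (real_of_int (r - i)) * measure_pmf.prob p {d. int d = r}" for r
  have "(\<Sum>\<^sub>\<infinity>r\<in>{i..}. real_of_int (r - i) * measure_pmf.prob p {d. int d = r}) =
      infsum f (range int)"
  proof (rule infsum_cong_neutral)
    fix r assume "r \<in> {i..} - range int"
    then have none: "{d. int d = r} = {}" by auto
    show "real_of_int (r - i) * measure_pmf.prob p {d. int d = r} = 0" unfolding none by simp
  qed (auto simp: f_def)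
  also have "\<dots> = infsum (f \<circ> int) UNIV" by (rule infsum_reindex) simp
  also have "f \<circ> int = (\<lambda>n. max 0 (real n - real_of_int i) * pmf p n)"
    by (auto simp: f_def measure_pmf_single)
  finally show ?thesis .
qed

lemma pmf_summable_on: "pmf p summable_on A"
  using pmf_abs_summable[of p A] abs_summable_summable abs_summable_equivalent by blast

lemma prob_eq_infsum_pmf: "measure_pmf.prob p A = infsum (pmf p) A"
  by (simp add: measure_pmf_conv_infsetsum infsetsum_infsum[OF pmf_abs_summable])

text \<open>The positive parts of n - (i - 1) and n - i differ by the indicator of n \<ge> i. The
  finite mean gives the convergence needed to add the sums.\<close>

lemma infsum_shortage_decrement:
  fixes p :: "nat pmf" and i :: int
  assumes "summable (\<lambda>n. real n * pmf p n)"
  shows "(\<Sum>\<^sub>\<infinity>r\<in>{i - 1..}. real_of_int (r - (i - 1)) * measure_pmf.prob p {d. int d = r}) =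
    (\<Sum>\<^sub>\<infinity>r\<in>{i..}. real_of_int (r - i) * measure_pmf.prob p {d. int d = r}) +
      measure_pmf.prob p {d. int d \<ge> i}"
proof -
  let ?A = "{d. int d \<ge> i}"
  have "(\<lambda>n. real n * pmf p n) summable_on UNIV"
    using assms by (subst summable_on_UNIV_nonneg_real_iff) simp_all
  then have bound: "(\<lambda>n. real n * pmf p n + \<bar>real_of_int i\<bar> * pmf p n) summable_on UNIV"
    by (intro summable_on_add summable_on_cmult_right pmf_summable_on)
  have sum1: "(\<lambda>n. max 0 (real n - real_of_int i) * pmf p n) summable_on UNIV"
  proof (rule summable_on_comparison_test[OF bound])
    fix n
    have "max 0 (real n - real_of_int i) * pmf p n \<le> (real n + \<bar>real_of_int i\<bar>) * pmf p n"
      by (intro mult_right_mono) auto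
    then show "max 0 (real n - real_of_int i) * pmf p n \<le> real n * pmf p n + \<bar>real_of_int i\<bar> * pmf p n"
      by (simp add: algebra_simps)
  qed simp
  have sum2: "(\<lambda>n. of_bool (int n \<ge> i) * pmf p n) summable_on UNIV"
    by (rule summable_on_comparison_test[OF pmf_summable_on[of p UNIV]]) auto
  have "infsum (\<lambda>n. of_bool (int n \<ge> i) * pmf p n) UNIV = infsum (pmf p) ?A"
    by (rule infsum_cong_neutral) auto
  then have prob: "measure_pmf.prob p ?A = infsum (\<lambda>n. of_bool (int n \<ge> i) * pmf p n) UNIV"
    by (simp add: prob_eq_infsum_pmf)
  have "max 0 (real n - real_of_int (i - 1)) * pmf p n =
      max 0 (real n - real_of_int i) * pmf p n + of_bool (int n \<ge> i) * pmf p n" for n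
  proof (cases "int n \<ge> i")
    case True
    then have "real n \<ge> real_of_int i" by linarith
    then show ?thesis using True by (simp add: algebra_simps)
  next
    case False
    then have "real n \<le> real_of_int (i - 1)" by linarith
    then show ?thesis using False by simp
  qed
  then show ?thesis
    unfolding infsum_shortage_eq prob infsum_add[OF sum1 sum2, symmetric] by simp
qed

text \<open>Shifting n to n + 1 cancels the factor n and leaves a multiple of the exponential
  series.\<close>

lemma summable_poisson_mean:
  assumes "0 < m"
  shows "summable (\<lambda>n. real n * pmf (poisson_pmf m) n)"
proof (subst summable_Suc_iff[symmetric])
  have "real (Suc n) * (m ^ Suc n / fact (Suc n) * exp (- m)) = m * exp (- m) * (inverse (fact n) * m ^ n)" for n
    by (simp add: field_simps del: of_nat_Suc)
  then show "summable (\<lambda>n. real (Suc n) * pmf (poisson_pmf m) (Suc n))"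
    using assms by (simp only: pmf_poisson) (intro summable_mult summable_exp)
qed

abbreviation demand_exceeds :: "'j inventory \<Rightarrow> ('j \<Rightarrow> int) \<Rightarrow> 'j \<Rightarrow> real" where
  "demand_exceeds P i j \<equiv> measure_pmf.prob (lead_demand P j) {d. int d \<ge> i j}"

lemma trigger_cost_decrement:
  fixes P :: "('j::finite) inventory"
  assumes "rate P j > 0" and "lead_time P > 0"
  shows "trigger_cost P (i(j := i j - 1)) =
    trigger_cost P i + stockout_cost P j * demand_exceeds P i j"
proof -
  have "summable (\<lambda>n. real n * pmf (lead_demand P j) n)"
    unfolding lead_demand_def using assms by (intro summable_poisson_mean) simp
  from infsum_shortage_decrement[OF this, of "i j"] show ?thesis
    unfolding trigger_cost_def by (subst (1 2) sum.remove[of _ j]) (simp_all add: distrib_left)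
qed

lemma trigger_cost_chain:
  fixes P :: "('j::finite) inventory"
  assumes "\<And>j. rate P j > 0" and "lead_time P > 0"
  shows "trigger_cost P (chain P \<omega> n) = trigger_cost P (capacity P) +
    (\<Sum>k<n. stockout_cost P (\<omega> !! k) * demand_exceeds P (chain P \<omega> k) (\<omega> !! k))"
  by (induction n) (simp_all add: trigger_cost_decrement assms del: fun_upd_apply)

section \<open>Expected cost through the mean cost increase per demand\<close>

text \<open>The mean increase of the trigger cost at the next demand. Split off from the fee, it is
  nonnegative and does not involve the optimal cost.\<close>

definition stockout_rate :: "('j::finite) inventory \<Rightarrow> ('j \<Rightarrow> int) \<Rightarrow> real" where
  "stockout_rate P i = (\<Sum>j\<in>UNIV. item_prob P j * stockout_cost P j * demand_exceeds P i j)"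

lemma entrance_fee_eq: "entrance_fee P i = stockout_rate P i - optimal_cost P / total_rate P"
  by (simp add: entrance_fee_def stockout_rate_def)

lemma total_rate_pos:
  fixes P :: "('j::finite) inventory"
  assumes "\<And>j. rate P j > 0"
  shows "total_rate P > 0"
  unfolding total_rate_def by (rule sum_pos) (use assms in auto)

lemma item_prob_pos:
  fixes P :: "('j::finite) inventory"
  assumes "\<And>j. rate P j > 0"
  shows "item_prob P j > 0"
  using total_rate_pos[OF assms] assms by (simp add: item_prob_def)

text \<open>The event that the lead-time demand reaches i j grows as i j falls. This serves twice:
  for the growth of the fee along paths, and to place all states below a positive-fee state in the
  trigger set.\<close>

lemma stockout_rate_antimono:
  fixes P :: "('j::finite) inventory"
  assumes "\<And>j. rate P j > 0" and "\<And>j. stockout_cost P j > 0" and "\<And>j. i j \<le> i' j"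
  shows "stockout_rate P i' \<le> stockout_rate P i"
  unfolding stockout_rate_def
proof (intro sum_mono mult_left_mono)
  show "demand_exceeds P i' j \<le> demand_exceeds P i j" for j
    using assms(3)[of j] by (intro measure_pmf.finite_measure_mono) auto
  show "0 \<le> item_prob P j * stockout_cost P j" for j
    using item_prob_pos[OF assms(1), of j] assms(2)[of j] by simp
qed

lemma
  fixes P :: "('j::finite) inventory"
  assumes "\<And>j. rate P j > 0" and "\<And>j. stockout_cost P j > 0"
  shows stockout_rate_nonneg: "0 \<le> stockout_rate P i"
    and stockout_rate_bounded: "stockout_rate P i \<le> (\<Sum>j\<in>UNIV. item_prob P j * stockout_cost P j)"
proof -
  have "0 \<le> item_prob P j * stockout_cost P j" for j
    using item_prob_pos[OF assms(1), of j] assms(2)[of j] by simp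
  then show "0 \<le> stockout_rate P i"
      and "stockout_rate P i \<le> (\<Sum>j\<in>UNIV. item_prob P j * stockout_cost P j)"
    unfolding stockout_rate_def by (auto intro!: sum_nonneg sum_mono mult_left_le)
qed

lemma measurable_stockout_rate_chain [measurable]:
  "(\<lambda>\<omega>. stockout_rate P (chain P \<omega> k)) \<in> borel_measurable (demand_space P)"
  by (rule measurable_increment[of "\<lambda>i _. stockout_rate P i"])

lemma integrable_stopped_stockout_rate:
  assumes "\<And>j. rate P j > 0" and "\<And>j. stockout_cost P j > 0" and "expected_steps P U < \<infinity>"
  shows "integrable (demand_space P)
    (\<lambda>\<omega>. \<Sum>k<the_enat (trigger_step P U \<omega>). stockout_rate P (chain P \<omega> k))"
proof (rule integrable_stopped_sum[OF assms(3)])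
  show "\<bar>stockout_rate P (chain P \<omega> k)\<bar> \<le> (\<Sum>j\<in>UNIV. item_prob P j * stockout_cost P j)" for k \<omega>
    using stockout_rate_nonneg[OF assms(1,2)] stockout_rate_bounded[OF assms(1,2)] by simp
qed measurable

lemma expected_cost_eq:
  fixes P :: "('j::finite) inventory"
  assumes rate: "\<And>j. rate P j > 0" and cost: "\<And>j. stockout_cost P j > 0"
    and "lead_time P > 0" and fin: "expected_steps P U < \<infinity>"
  shows "expected_cost P U = trigger_cost P (capacity P) +
    (\<integral>\<omega>. (\<Sum>k<the_enat (trigger_step P U \<omega>). stockout_rate P (chain P \<omega> k)) \<partial>demand_space P)"
proof -
  interpret prob_space "demand_space P" by (rule prob_space_demand_space)
  define \<phi> where "\<phi> i j = stockout_cost P j * demand_exceeds P i j" for i j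
  have nonneg: "0 \<le> \<phi> i j" for i j using cost[of j] by (simp add: \<phi>_def)
  \<comment> \<open>A uniform bound makes the stopped sum integrable, so the initial cost can be
    separated from it under the integral.\<close>
  have bound: "\<bar>\<phi> i j\<bar> \<le> (\<Sum>j\<in>UNIV. stockout_cost P j)" for i j
  proof -
    have "\<phi> i j \<le> stockout_cost P j" using cost[of j] by (simp add: \<phi>_def mult_left_le)
    also have "\<dots> \<le> (\<Sum>j\<in>UNIV. stockout_cost P j)"
      by (rule member_le_sum) (use cost in \<open>auto intro: less_imp_le\<close>)
    finally show ?thesis using nonneg by simp
  qed
  have "expected_cost P U = (\<integral>\<omega>. trigger_cost P (capacity P) +
      (\<Sum>k<the_enat (trigger_step P U \<omega>). \<phi> (chain P \<omega> k) (\<omega> !! k)) \<partial>demand_space P)"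
    unfolding expected_cost_def \<phi>_def by (simp add: trigger_cost_chain rate \<open>lead_time P > 0\<close>)
  also have "\<dots> = trigger_cost P (capacity P) +
      (\<integral>\<omega>. (\<Sum>k<the_enat (trigger_step P U \<omega>). \<phi> (chain P \<omega> k) (\<omega> !! k)) \<partial>demand_space P)"
    by (subst Bochner_Integration.integral_add)
      (auto intro!: integrable_stopped_sum[OF fin _ bound] measurable_increment simp: prob_space)
  also have "(\<integral>\<omega>. (\<Sum>k<the_enat (trigger_step P U \<omega>). \<phi> (chain P \<omega> k) (\<omega> !! k)) \<partial>demand_space P) =
      (\<integral>\<omega>. (\<Sum>k<the_enat (trigger_step P U \<omega>). stockout_rate P (chain P \<omega> k)) \<partial>demand_space P)"
    by (subst integral_increments_until_trigger[OF fin nonneg])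
      (simp add: stockout_rate_def \<phi>_def pmf_item_pmf rate mult.assoc)
  finally show ?thesis .
qed

text \<open>Foster--Lyapunov argument: as long as some \<open>i j > m j\<close>, the potential
  \<open>\<Sum>j. max 0 (i j - m j)\<close> drops by one with probability at least \<open>min\<^sub>j item_prob P j\<close>.\<close>

lemma expected_steps_finite:
  fixes P :: "('j::finite) inventory" and m :: "'j \<Rightarrow> int"
  assumes rate: "\<And>j. rate P j > 0"
    and lower: "\<And>i. i \<in> states P \<Longrightarrow> (\<And>j. i j \<le> m j) \<Longrightarrow> i \<in> U"
  shows "expected_steps P U < \<infinity>"
proof -
  interpret prob_space "demand_space P" by (rule prob_space_demand_space)
  define h where "h i = (\<Sum>j\<in>UNIV. max 0 (real_of_int (i j - m j)))" for i
  define \<phi> :: "('j \<Rightarrow> int) \<Rightarrow> 'j \<Rightarrow> ennreal" where "\<phi> i j = of_bool (m j < i j)" for i j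
  define q where "q = Min (range (item_prob P))"
  have q_pos: "0 < q" unfolding q_def by (simp add: item_prob_pos[OF rate])
  have h_nonneg: "0 \<le> h i" for i unfolding h_def by (simp add: sum_nonneg)
  \<comment> \<open>States are integral, so i j > m j means i j - m j \<ge> 1 and the drop is
    exactly one; otherwise the positive part stays 0.\<close>
  have h_decrement: "h (i(j := i j - 1)) + of_bool (m j < i j) = h i" for i j
    unfolding h_def by (subst (1 2) sum.remove[of _ j]) auto
  \<comment> \<open>On every path the demands that lower the potential number at most its initial
    value.\<close>
  have telescope: "(\<Sum>k<n. \<phi> (chain P \<omega> k) (\<omega> !! k)) \<le> ennreal (h (capacity P))" for n \<omega>
  proof -
    have "h (chain P \<omega> n) + (\<Sum>k<n. of_bool (m (\<omega> !! k) < chain P \<omega> k (\<omega> !! k))) = h (capacity P)"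
    proof (induction n)
      case (Suc n)
      then show ?case using h_decrement[of "chain P \<omega> n" "\<omega> !! n"]
        by (simp del: fun_upd_apply)
    qed simp
    then have "(\<Sum>k<n. of_bool (m (\<omega> !! k) < chain P \<omega> k (\<omega> !! k))) \<le> h (capacity P)"
      using h_nonneg[of "chain P \<omega> n"] by linarith
    moreover have "(\<Sum>k<n. \<phi> (chain P \<omega> k) (\<omega> !! k)) =
        ennreal (\<Sum>k<n. of_bool (m (\<omega> !! k) < chain P \<omega> k (\<omega> !! k)))"
      by (simp add: \<phi>_def ennreal_of_nat_eq_real_of_nat)
    ultimately show ?thesis by (simp add: ennreal_leI)
  qed
  have drift: "ennreal q \<le> (\<integral>\<^sup>+j. \<phi> (chain P \<omega> k) j \<partial>measure_pmf (item_pmf P))"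
    if "enat k < trigger_step P U \<omega>" for k \<omega>
  proof -
    have "chain P \<omega> k \<notin> U" using that by (simp add: less_trigger_step_iff)
    then obtain j where j: "m j < chain P \<omega> k j"
      using lower[OF chain_in_states] not_less by blast
    have "ennreal q \<le> ennreal (item_prob P j)"
      unfolding q_def by (intro ennreal_leI Min_le) auto
    also have "\<dots> = ennreal (pmf (item_pmf P) j) * \<phi> (chain P \<omega> k) j"
      using j by (simp add: \<phi>_def pmf_item_pmf rate)
    also have "\<dots> \<le> (\<Sum>j\<in>UNIV. ennreal (pmf (item_pmf P) j) * \<phi> (chain P \<omega> k) j)"
      by (rule member_le_sum) auto
    also have "\<dots> = (\<integral>\<^sup>+j. \<phi> (chain P \<omega> k) j \<partial>measure_pmf (item_pmf P))"
      by (subst nn_integral_measure_pmf_support[of UNIV]) (auto simp: mult.commute)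
    finally show ?thesis .
  qed
  have meas: "(\<lambda>\<omega>. ennreal_of_enat (trigger_step P U \<omega>)) \<in> borel_measurable (demand_space P)"
    by (rule measurable_compose[OF measurable_trigger_step]) simp
  \<comment> \<open>Each step before the trigger is charged q. By the drift bound and Dynkin's
    formula the expected charge is at most the expected number of lowering demands.\<close>
  have "ennreal q * expected_steps P U =
      (\<integral>\<^sup>+\<omega>. ennreal q * ennreal_of_enat (trigger_step P U \<omega>) \<partial>demand_space P)"
    unfolding expected_steps_def by (rule nn_integral_cmult[OF meas, symmetric])
  also have "\<dots> = (\<integral>\<^sup>+\<omega>. (\<Sum>k. if enat k < trigger_step P U \<omega> then ennreal q else 0) \<partial>demand_space P)"
    unfolding ennreal_of_enat_eq_suminf ennreal_suminf_cmult[symmetric]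
    by (intro nn_integral_cong suminf_cong) simp
  also have "\<dots> \<le> (\<integral>\<^sup>+\<omega>. (\<Sum>k. if enat k < trigger_step P U \<omega>
      then (\<integral>\<^sup>+j. \<phi> (chain P \<omega> k) j \<partial>measure_pmf (item_pmf P)) else 0) \<partial>demand_space P)"
    by (intro nn_integral_mono suminf_le) (auto simp: drift)
  also have "\<dots> = (\<integral>\<^sup>+\<omega>. (\<Sum>k. if enat k < trigger_step P U \<omega>
      then \<phi> (chain P \<omega> k) (\<omega> !! k) else 0) \<partial>demand_space P)"
    by (rule nn_integral_increments_until_trigger[symmetric])
  also have "\<dots> \<le> (\<integral>\<^sup>+\<omega>. ennreal (h (capacity P)) \<partial>demand_space P)"
  proof (intro nn_integral_mono suminf_le_const)
    fix \<omega> n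
    have "(\<Sum>k<n. if enat k < trigger_step P U \<omega> then \<phi> (chain P \<omega> k) (\<omega> !! k) else 0)
        \<le> (\<Sum>k<n. \<phi> (chain P \<omega> k) (\<omega> !! k))"
      by (rule sum_mono) simp
    then show "(\<Sum>k<n. if enat k < trigger_step P U \<omega> then \<phi> (chain P \<omega> k) (\<omega> !! k) else 0)
        \<le> ennreal (h (capacity P))"
      using telescope by (rule order_trans)
  qed simp
  also have "\<dots> = ennreal (h (capacity P))" by (simp add: emeasure_space_1)
  finally have "ennreal q * expected_steps P U < \<infinity>"
    by (metis ennreal_less_top infinity_ennreal_def order_le_less_trans)
  then show ?thesis
    using q_pos by (auto simp: ennreal_mult_less_top ennreal_eq_0_iff)
qed

section \<open>Pathwise comparison and optimality\<close>

text \<open>The partial sums fall up to s and rise from there on.\<close>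

lemma sum_lessThan_le_of_sign_change:
  fixes a :: "nat \<Rightarrow> real"
  assumes "\<And>k. k < s \<Longrightarrow> a k \<le> 0" and "\<And>k. s \<le> k \<Longrightarrow> 0 \<le> a k"
  shows "(\<Sum>k<s. a k) \<le> (\<Sum>k<n. a k)"
proof (cases "s \<le> n")
  case True
  then show ?thesis by (intro sum_mono2) (auto intro: assms(2))
next
  case False
  then have "(\<Sum>k<s. a k) = (\<Sum>k<n. a k) + (\<Sum>k\<in>{n..<s}. a k)"
    by (simp add: lessThan_atLeast0 sum.atLeastLessThan_concat)
  then show ?thesis using sum_nonpos[of "{n..<s}" a] assms(1) by simp
qed

text \<open>Charging the fee \<open>stockout_rate - c\<close> at every step, the positive-fee region is absorbing;
  hence stopping on entering it minimises the total fee pathwise.\<close>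

lemma stopping_at_positive_fee_minimal:
  fixes P :: "('j::finite) inventory" and c :: real
  defines "V \<equiv> {i \<in> states P. stockout_rate P i > c}"
  assumes rate: "\<And>j. rate P j > 0" and cost: "\<And>j. stockout_cost P j > 0" and "lead_time P > 0"
    and finV: "expected_steps P V < \<infinity>" and finU: "expected_steps P U < \<infinity>"
  shows "expected_cost P V - c * enn2real (expected_steps P V) \<le>
    expected_cost P U - c * enn2real (expected_steps P U)"
proof -
  define fee where "fee W \<omega> = (\<Sum>k<the_enat (trigger_step P W \<omega>). stockout_rate P (chain P \<omega> k) - c)"
    for W \<omega>
  have split: "fee W \<omega> = (\<Sum>k<the_enat (trigger_step P W \<omega>). stockout_rate P (chain P \<omega> k))
      - c * real (the_enat (trigger_step P W \<omega>))" for W \<omega>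
    by (simp add: fee_def sum_subtractf mult.commute)
  have int: "integrable (demand_space P) (fee W)"
    and fee: "expected_cost P W - c * enn2real (expected_steps P W) =
      trigger_cost P (capacity P) + (\<integral>\<omega>. fee W \<omega> \<partial>demand_space P)"
    if fin: "expected_steps P W < \<infinity>" for W
    unfolding split[abs_def]
    using integrable_stopped_stockout_rate[OF rate cost fin] integrable_the_trigger_step[OF fin]
    by (simp_all add: expected_cost_eq[OF rate cost \<open>lead_time P > 0\<close> fin]
        flip: integral_the_trigger_step[OF fin])
  \<comment> \<open>A finite step for V locates the sign change of the fees; the comparison then
    holds against every natural number of steps, whatever \<open>the_enat\<close> returns for
    U.\<close>
  have "AE \<omega> in demand_space P. fee V \<omega> \<le> fee U \<omega>"
    using AE_trigger_step_finite[OF finV]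
  proof eventually_elim
    case (elim \<omega>)
    then obtain s where s: "trigger_step P V \<omega> = enat s" by auto
    have iff: "k < s \<longleftrightarrow> (\<forall>l\<le>k. chain P \<omega> l \<notin> V)" for k
      using less_trigger_step_iff[of k P V \<omega>] s by simp
    show ?case unfolding fee_def s the_enat.simps
    proof (rule sum_lessThan_le_of_sign_change)
      fix k assume "k < s"
      then have "chain P \<omega> k \<notin> V" using iff by blast
      then show "stockout_rate P (chain P \<omega> k) - c \<le> 0"
        by (simp add: V_def chain_in_states)
    next
      fix k assume "s \<le> k"
      then obtain l where "l \<le> k" "chain P \<omega> l \<in> V" using iff[of k] not_less by blast
      moreover from \<open>l \<le> k\<close> have "stockout_rate P (chain P \<omega> l) \<le> stockout_rate P (chain P \<omega> k)"
        by (intro stockout_rate_antimono rate cost chain_antimono)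
      ultimately show "0 \<le> stockout_rate P (chain P \<omega> k) - c"
        by (simp add: V_def)
    qed
  qed
  then have "(\<integral>\<omega>. fee V \<omega> \<partial>demand_space P) \<le> (\<integral>\<omega>. fee U \<omega> \<partial>demand_space P)"
    by (rule integral_mono_AE[OF int[OF finV] int[OF finU]])
  then show ?thesis unfolding fee[OF finV] fee[OF finU] by simp
qed

theorem corollary1:
  fixes P :: "('j::finite) inventory"
  assumes "\<And>j. capacity P j \<ge> 1"
    and "\<And>j. rate P j > 0"
    and "\<And>j. stockout_cost P j > 0"
    and "fixed_cost P > 0"
    and "lead_time P > 0"
    and "\<exists>U. is_arg_min (average_cost P) (admissible P) U"
    and "entrance_fee P (capacity P) \<le> 0"
    and "\<exists>i\<in>states P. entrance_fee P i > 0"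
  defines "U_star \<equiv> {i \<in> states P. entrance_fee P i > 0}"
  shows "continue_set P U_star = {i \<in> states P. entrance_fee P i \<le> 0}
    \<and> is_arg_min (average_cost P) (admissible P) U_star
    \<and> average_cost P U_star = optimal_cost P"
proof -
  let ?a = "optimal_cost P" and ?\<Lambda> = "total_rate P" and ?L = "lead_time P"
  let ?E = "\<lambda>U. enn2real (expected_steps P U)"
  note rate = assms(2) and cost = assms(3)
  have \<Lambda>_pos: "?\<Lambda> > 0" by (rule total_rate_pos[OF rate])
  have U_star: "U_star = {i \<in> states P. stockout_rate P i > ?a / ?\<Lambda>}"
    unfolding U_star_def entrance_fee_eq by auto
  \<comment> \<open>This state is the threshold below which every state has positive fee.\<close>
  obtain m where m: "m \<in> states P" "stockout_rate P m > ?a / ?\<Lambda>"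
    using assms(8) by (auto simp: entrance_fee_eq)
  have fin: "expected_steps P U_star < \<infinity>"
  proof (rule expected_steps_finite[OF rate])
    fix i assume "i \<in> states P" and "\<And>j. i j \<le> m j"
    then show "i \<in> U_star"
      using stockout_rate_antimono[OF rate cost, of i m] m(2) by (simp add: U_star)
  qed
  have adm: "admissible P U_star"
    unfolding admissible_def using fin assms(7) by (auto simp: U_star_def)
  obtain U where U: "is_arg_min (average_cost P) (admissible P) U" using assms(6) by blast
  have U_min: "average_cost P U \<le> average_cost P W" if "admissible P W" for W
    using U that by (force simp: is_arg_min_def not_less)
  have U_adm: "admissible P U" using U by (simp add: is_arg_min_def)
  have opt: "?a = average_cost P U"
    unfolding optimal_cost_def by (rule cInf_eq_minimum) (use U_adm U_min in auto)
  have cycle_pos: "?L + ?E W / ?\<Lambda> > 0" for W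
    using assms(5) \<Lambda>_pos by (intro add_pos_nonneg) simp_all
  have "expected_cost P U = ?a * (?L + ?E U / ?\<Lambda>)"
    using cycle_pos[of U] by (simp add: opt average_cost_def)
  \<comment> \<open>The fee comparison with c = \<alpha>*/\<Lambda>. On the right the term in the
    expected steps of U cancels against the cycle length, leaving \<alpha>* times the lead
    time.\<close>
  moreover have "expected_cost P U_star - ?a / ?\<Lambda> * ?E U_star \<le>
      expected_cost P U - ?a / ?\<Lambda> * ?E U"
    unfolding U_star
    by (rule stopping_at_positive_fee_minimal[OF rate cost assms(5)])
      (use fin U_adm in \<open>simp_all add: U_star admissible_def\<close>)
  ultimately have "expected_cost P U_star \<le> ?a * (?L + ?E U_star / ?\<Lambda>)"
    by (simp add: distrib_left)
  then have "average_cost P U_star \<le> ?a"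
    unfolding average_cost_def using cycle_pos[of U_star] by (simp add: pos_divide_le_eq)
  then have eq: "average_cost P U_star = ?a" using U_min[OF adm] opt by simp
  moreover have "is_arg_min (average_cost P) (admissible P) U_star"
    unfolding is_arg_min_def using adm U_min eq opt by (force simp: not_less)
  moreover have "continue_set P U_star = {i \<in> states P. entrance_fee P i \<le> 0}"
    unfolding continue_set_def U_star_def by auto
  ultimately show ?thesis by blast
qed

end
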